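(* Let $X:[0,\infty)\to\mathbb{R}^n$ be a càdlàg function and let $i\in\{1,\ldots,n\}$. Then the following conditions are equivalent: (i) $\lim_{t\to\infty}[W_i(a+X)(t)-W_i(X)(t)]=0$ for all $a\in[0,\infty)^n$. (ii) $\lim_{t\to\infty}L_i(a+X)(t)=\infty$ for some $a\in[0,\infty)^n$. (iii) $\lim_{t\to\infty}L_i(a+X)(t)=\infty$ for all $a\in[0,\infty)^n$.
   Context: Fix $n\ge 1$ and an $n\times n$ matrix $P=(p_{ij})$ with nonnegative entries and spectral radius strictly less than one. Put $R=I-P^t$, where $^t$ denotes transposition. For a càdlàg (right continuous with left limits) function $X:[0,\infty)\to\mathbb{R}^n$, the reflection map (Skorohod problem in $[0,\infty)^n$) gives the unique pair $(W(X),L(X))$ of $\mathbb{R}^n$-valued functions on $[0,\infty)$ with $W(X)(t)=X(t)+R\,L(X)(t)$ for all $t\ge 0$ and, for each $i=1,\ldots,n$: (S1) $L_i(X)$ is nondecreasing, nonnegative and right continuous; (S2) $W_i(X)$ is nonnegative; (S3) $\int_{[0,\infty)}1_{\{W_i(X)(t)>0\}}\,dL_i(X)(t)=0$, where the measure $dL_i(X)$ has an atom of mass $L_i(X)(0)$ at $0$. (It is known that this pair exists and is unique.) A subscript $i$ denotes the $i$th coordinate, and for a constant vector $a$, $a+X$ denotes the function $t\mapsto a+X(t)$. *)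

theory Defs
  imports "HOL-Analysis.Analysis"
begin

text \<open>Paths on \<open>[0,\<infinity>)\<close> are represented by functions on the type \<open>real\<close>; every notion below
  only constrains their values at times \<open>t \<ge> 0\<close>.\<close>

definition cadlag :: "(real \<Rightarrow> 'a::topological_space) \<Rightarrow> bool" where
  "cadlag X \<longleftrightarrow>
     (\<forall>t\<ge>0. (X \<longlongrightarrow> X t) (at_right t)) \<and> (\<forall>t>0. \<exists>l. (X \<longlongrightarrow> l) (at_left t))"

text \<open>The eigenvalues of a real matrix are taken in the complex numbers.\<close>

definition complex_eigenvalues :: "real^'n^'n \<Rightarrow> complex set" where
  "complex_eigenvalues A =
     {\<mu>. \<exists>v::complex^'n. v \<noteq> 0 \<and> (\<chi> i j. complex_of_real (A $ i $ j)) *v v = \<mu> *s v}"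

definition matrix_spectral_radius :: "real^'n^'n \<Rightarrow> real" where
  "matrix_spectral_radius A = (SUP \<mu>\<in>complex_eigenvalues A. cmod \<mu>)"

text \<open>Extending the integrator by \<open>0\<close> to negative times gives its Stieltjes measure
  an atom of mass \<open>l 0\<close> at \<open>0\<close>.\<close>

definition stieltjes_measure :: "(real \<Rightarrow> real) \<Rightarrow> real measure" where
  "stieltjes_measure l = interval_measure (\<lambda>t. if t < 0 then 0 else l t)"

definition skorohod_solution ::
    "real^'n^'n \<Rightarrow> (real \<Rightarrow> real^'n) \<Rightarrow> (real \<Rightarrow> real^'n) \<Rightarrow> (real \<Rightarrow> real^'n) \<Rightarrow> bool" where
  "skorohod_solution R X W L \<longleftrightarrow>
     (\<forall>t\<ge>0. W t = X t + R *v L t) \<and>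
     (\<forall>i. mono_on {0..} (\<lambda>t. L t $ i) \<and>
          (\<forall>t\<ge>0. 0 \<le> L t $ i) \<and>
          (\<forall>t\<ge>0. ((\<lambda>s. L s $ i) \<longlongrightarrow> L t $ i) (at_right t)) \<and>
          (\<forall>t\<ge>0. 0 \<le> W t $ i) \<and>
          (\<integral>\<^sup>+ t\<in>{0..}. indicator {s. 0 < W s $ i} t \<partial>stieltjes_measure (\<lambda>t. L t $ i)) = 0)"

definition reflection_matrix :: "real^'n^'n \<Rightarrow> real^'n^'n" where
  "reflection_matrix P = mat 1 - transpose P"

text \<open>The solution is unique on \<open>[0,\<infinity>)\<close>; \<open>SOME\<close> instead of \<open>THE\<close> only
  accounts for the unconstrained values at negative times.\<close>

definition reflection_map ::
    "real^'n^'n \<Rightarrow> (real \<Rightarrow> real^'n) \<Rightarrow> (real \<Rightarrow> real^'n) \<times> (real \<Rightarrow> real^'n)" where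
  "reflection_map P X = (SOME (W, L). skorohod_solution (reflection_matrix P) X W L)"

definition reflected :: "real^'n^'n \<Rightarrow> (real \<Rightarrow> real^'n) \<Rightarrow> real \<Rightarrow> real^'n" where
  "reflected P X = fst (reflection_map P X)"

definition regulator :: "real^'n^'n \<Rightarrow> (real \<Rightarrow> real^'n) \<Rightarrow> real \<Rightarrow> real^'n" where
  "regulator P X = snd (reflection_map P X)"

end

theory Submission
  imports Defs
begin

text \<open>
  Write \<open>Q = P\<^sup>T\<close>, so that \<open>W(X) = X + (I - Q) L(X)\<close>, and for \<open>a \<ge> 0\<close> let
  \<open>D(t) = L(X)(t) - L(a + X)(t)\<close>. The theorem rests on three facts: \<open>D\<close> is nonnegative and
  nondecreasing, \<open>W(X) \<le> W(a + X)\<close> (both in \<open>solution_shift\<close>), and \<open>D\<close> is bounded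
  (\<open>regulator_diff_bounded\<close>).

  Boundedness of \<open>D\<close> shows that \<open>L\<^sub>i(a + X)\<close> tends to infinity for one \<open>a\<close> iff it does so for
  all \<open>a\<close>, namely iff \<open>L\<^sub>i(X)\<close> does. Being monotone and bounded, \<open>D\<close> converges, hence so does
  \<open>W(a + X) - W(X) = a + Q D - D\<close>. If \<open>L\<^sub>i(a + X)\<close> is unbounded, then \<open>W\<^sub>i(a + X)\<close> vanishes at
  arbitrarily late times (\<open>complementary_unbounded_zero\<close>), and with it the smaller \<open>W\<^sub>i(X)\<close>, so the
  limit of the difference in coordinate \<open>i\<close> is \<open>0\<close>. Conversely, if \<open>L\<^sub>i(X) < B\<close>, then
  \<open>D\<^sub>i < B\<close>, and a shift of coordinate \<open>i\<close> by \<open>\<bar>B\<bar> + 1\<close> keeps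
  \<open>W\<^sub>i(a + X) - W\<^sub>i(X) \<ge> a\<^sub>i - D\<^sub>i\<close> at or above \<open>1\<close> forever.

  The comparison of \<open>X\<close> with \<open>a + X\<close> needs the solutions in constructive form. In one dimension
  the regulator is the running maximum of the negative part of the input, and the Stieltjes
  condition characterises it (\<open>complementary_regulator1\<close>, \<open>complementary_imp_regulator1\<close>).
  Coordinate by coordinate this makes \<open>L(X)\<close> a fixed point, obtained as the limit of increasing
  Picard iterates, and the comparison is proved for the iterates by induction
  (\<open>picard_shift\<close>). All analytic estimates come from a discrete maximum principle
  (\<open>max_principle\<close>): the spectral radius condition provides a vector \<open>v \<ge> 0\<close> with
  \<open>v = 1 + Q v\<close> (\<open>positive_potential_exists\<close>), and then \<open>d \<le> Q d + e\<close> implies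
  \<open>d \<le> e v\<close>.\<close>

section \<open>A positive potential for nonnegative matrices of spectral radius below one\<close>

lemma matrix_vector_mult_nth_mono:
  fixes Q :: "real^'n^'m"
  assumes "\<And>i j. 0 \<le> Q $ i $ j" and "\<And>j. x $ j \<le> y $ j"
  shows "(Q *v x) $ i \<le> (Q *v y) $ i"
  unfolding matrix_vector_mult_def by (auto intro!: sum_mono mult_left_mono assms)

text \<open>Without this bound the supremum that defines the spectral radius would be an arbitrary value.\<close>
lemma bdd_above_complex_eigenvalues:
  fixes A :: "real^'n^'n"
  shows "bdd_above (cmod ` complex_eigenvalues A)"
proof -
  define C where "C = (\<chi> i j. complex_of_real (A $ i $ j))"
  have "linear (\<lambda>x. C *v x)"
    by (rule linearI)
      (simp_all add: vec_eq_iff matrix_vector_mult_def scaleR_sum_right distrib_left sum.distrib)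
  then have bl: "bounded_linear (\<lambda>x. C *v x)"
    by (simp add: linear_conv_bounded_linear)
  obtain K where K: "\<And>x. norm (C *v x) \<le> norm x * K"
    using bounded_linear.bounded[OF bl] by blast
  have "cmod \<mu> \<le> K" if "\<mu> \<in> complex_eigenvalues A" for \<mu>
  proof -
    from that obtain x where x: "x \<noteq> 0" "C *v x = \<mu> *s x"
      unfolding complex_eigenvalues_def C_def by auto
    have "norm (\<mu> *s x) = cmod \<mu> * norm x"
      by (simp add: norm_vec_def L2_set_right_distrib norm_mult)
    with K[of x] x have "cmod \<mu> * norm x \<le> K * norm x" by (simp add: mult.commute)
    with x show ?thesis by simp
  qed
  then show ?thesis by (auto intro!: bdd_aboveI)
qed

lemma real_eigenvalue_le_spectral_radius:
  fixes A :: "real^'n^'n"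
  assumes "A *v x = \<mu> *\<^sub>R x" and "x \<noteq> 0"
  shows "\<bar>\<mu>\<bar> \<le> matrix_spectral_radius A"
proof -
  define z :: "complex^'n" where "z = (\<chi> i. complex_of_real (x $ i))"
  have "z \<noteq> 0" using \<open>x \<noteq> 0\<close> by (auto simp: z_def vec_eq_iff)
  moreover have "(\<chi> i j. complex_of_real (A $ i $ j)) *v z = complex_of_real \<mu> *s z"
  proof -
    have "(\<Sum>j\<in>UNIV. A $ i $ j * x $ j) = \<mu> * x $ i" for i
      using arg_cong[OF assms(1), of "\<lambda>y. y $ i"] by (simp add: matrix_vector_mult_def)
    then show ?thesis
      by (simp add: vec_eq_iff matrix_vector_mult_def z_def flip: of_real_mult of_real_sum)
  qed
  ultimately have "complex_of_real \<mu> \<in> complex_eigenvalues A"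
    unfolding complex_eigenvalues_def by blast
  then have "cmod (complex_of_real \<mu>) \<le> matrix_spectral_radius A"
    unfolding matrix_spectral_radius_def
    by (intro cSUP_upper bdd_above_complex_eigenvalues)
  then show ?thesis by simp
qed

text \<open>A kernel vector of \<open>I - tP\<close> would give an eigenvector of \<open>P\<close> with eigenvalue
  \<open>1 / t \<ge> 1\<close>.\<close>
lemma det_id_minus_scaled_nonzero:
  fixes P :: "real^'n^'n"
  assumes "matrix_spectral_radius P < 1" and "0 \<le> t" "t \<le> 1"
  shows "det (mat 1 - t *\<^sub>R transpose P) \<noteq> 0"
proof
  assume "det (mat 1 - t *\<^sub>R transpose P) = 0"
  moreover have "mat 1 - t *\<^sub>R transpose P = transpose (mat 1 - t *\<^sub>R P)"
    by (simp add: vec_eq_iff transpose_def mat_def)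
  ultimately have "det (mat 1 - t *\<^sub>R P) = 0" by (simp add: det_transpose)
  then obtain x where x: "x \<noteq> 0" "(mat 1 - t *\<^sub>R P) *v x = 0"
    using matrix_left_invertible_ker[of "mat 1 - t *\<^sub>R P"] invertible_det_nz[of "mat 1 - t *\<^sub>R P"]
    by (auto simp: invertible_left_inverse)
  then have eq: "x = t *\<^sub>R (P *v x)"
    by (simp add: matrix_vector_mult_diff_rdistrib flip: scaleR_matrix_vector_assoc)
  with x have "t \<noteq> 0" by auto
  then have "P *v x = (1 / t) *\<^sub>R x" by (subst (2) eq) simp
  then have "\<bar>1 / t\<bar> \<le> matrix_spectral_radius P"
    using x by (intro real_eigenvalue_le_spectral_radius)
  moreover have "1 \<le> \<bar>1 / t\<bar>" using assms \<open>t \<noteq> 0\<close> by simp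
  ultimately show False using assms by simp
qed

text \<open>The solution \<open>v t\<close> of
  \<open>v = 1 + t P\<^sup>T v\<close> exists for all \<open>t\<close> in the unit interval and, by Cramer's rule, depends
  continuously on \<open>t\<close>. Wherever \<open>v t\<close> is nonnegative the equation improves the bound to
  \<open>v t \<ge> 1\<close>, so the parameters with \<open>v t \<ge> 1\<close> and those with some coordinate \<open>\<le> 0\<close> form
  two disjoint closed sets that cover the interval. As \<open>v 0 = 1\<close>, connectedness excludes the second.\<close>
lemma positive_potential_exists:
  fixes P :: "real^'n^'n"
  assumes nonneg: "\<And>j k. 0 \<le> P $ j $ k" and "matrix_spectral_radius P < 1"
  obtains v :: "real^'n" where "\<And>i. 0 \<le> v $ i" and "\<And>i. v $ i = 1 + (transpose P *v v) $ i"
proof -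
  define A where "A t = mat 1 - t *\<^sub>R transpose P" for t
  have det: "det (A t) \<noteq> 0" if "t \<in> {0..1}" for t
    using det_id_minus_scaled_nonzero[OF assms(2)] that by (simp add: A_def)
  define v where "v t = (\<chi> k. det (\<chi> i j. if j = k then 1 else A t $ i $ j) / det (A t))" for t :: real
  have solves: "A t *v v t = (\<chi> i. 1)" if "t \<in> {0..1}" for t
    using cramer[OF det[OF that], of "v t" "\<chi> i. 1"] by (simp add: v_def cong: if_cong)
  then have v: "v t $ i = 1 + t * (transpose P *v v t) $ i" if "t \<in> {0..1}" for t i
  proof -
    have "(A t *v v t) $ i = v t $ i - t * (transpose P *v v t) $ i"
      by (simp add: A_def matrix_vector_mult_diff_rdistrib flip: scaleR_matrix_vector_assoc)
    with solves[OF that] show ?thesis by simp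
  qed
  have cont: "continuous_on {0..1} (\<lambda>t. v t $ k)" for k
  proof -
    have entry: "continuous_on {0..1} (\<lambda>t. A t $ i $ j)" for i j
      unfolding A_def by (simp add: mat_def) (intro conjI impI continuous_intros)
    have "continuous_on {0..1} (\<lambda>t. if j = k then 1 else A t $ i $ j)" for i j
      using entry by (cases "j = k") auto
    then have "continuous_on {0..1} (\<lambda>t. det (\<chi> i j. if j = k then 1 else A t $ i $ j))"
      unfolding det_def vec_lambda_beta by (intro continuous_intros)
    moreover have "continuous_on {0..1} (\<lambda>t. det (A t))"
      unfolding det_def by (intro continuous_intros entry)
    ultimately show ?thesis
      unfolding v_def vec_lambda_beta using det by (intro continuous_on_divide) auto
  qed
  have dichotomy: "1 \<le> v t $ i" if "t \<in> {0..1}" "\<And>j. 0 \<le> v t $ j" for t i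
  proof -
    have "(transpose P *v 0) $ i \<le> (transpose P *v v t) $ i"
      by (rule matrix_vector_mult_nth_mono) (use nonneg that in \<open>auto simp: transpose_def\<close>)
    then show ?thesis using v[OF that(1), of i] that by (simp add: mult_nonneg_nonneg)
  qed
  \<comment> \<open>By the dichotomy these two sets cover the unit interval.\<close>
  define S where "S = (\<Inter>i. {t \<in> {0..1::real}. 1 \<le> v t $ i})"
  define T where "T = (\<Union>i. {t \<in> {0..1::real}. v t $ i \<le> 0})"
  have "closed S" "closed T"
    unfolding S_def T_def
    by (intro closed_INT closed_UN ballI continuous_on_closed_Collect_le cont continuous_on_const
        closed_atLeastAtMost finite)+
  moreover have "S \<inter> T \<inter> {0..1} = {}"
  proof -
    have "t \<notin> T" if "t \<in> S" for t
      using that by (auto simp: S_def T_def not_le intro: less_le_trans[OF zero_less_one])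
    then show ?thesis by blast
  qed
  moreover have "{0..1} \<subseteq> S \<union> T"
  proof
    fix t :: real assume t: "t \<in> {0..1}"
    then have "t \<in> S" if "t \<notin> T"
      using that dichotomy[OF t] by (auto simp: S_def T_def not_le intro: less_imp_le)
    then show "t \<in> S \<union> T" by blast
  qed
  moreover have "0 \<in> S" using v[of 0] by (simp add: S_def)
  ultimately have "T \<inter> {0..1} = {}"
    using connected_closedD[of "{0..1::real}" S T] by fastforce
  then have "1 \<in> S"
    using \<open>{0..1} \<subseteq> S \<union> T\<close> by (metis Int_iff Un_iff atLeastAtMost_iff empty_iff order_refl subsetD zero_le_one)
  then have "1 \<le> v 1 $ i" for i by (simp add: S_def)
  then show thesis using v[of 1] by (intro that[of "v 1"]) (auto intro: order_trans[of 0 1])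
qed

section \<open>The one-dimensional regulator\<close>

definition lower_bounded :: "(real \<Rightarrow> real) \<Rightarrow> bool" where
  "lower_bounded x \<longleftrightarrow> (\<forall>T. bdd_below (x ` {0..T}))"

text \<open>The regulator of the one-dimensional Skorohod problem for \<open>x\<close>.\<close>
definition regulator1 :: "(real \<Rightarrow> real) \<Rightarrow> real \<Rightarrow> real" where
  "regulator1 x t = (SUP s\<in>{0..t}. max 0 (- x s))"

lemma bdd_above_deficit:
  assumes "lower_bounded x"
  shows "bdd_above ((\<lambda>s. max 0 (- x s)) ` {0..t})"
proof -
  obtain m where "\<And>s. s \<in> {0..t} \<Longrightarrow> m \<le> x s"
    using assms unfolding lower_bounded_def bdd_below_def by (metis imageI)
  then show ?thesis
    by (intro bdd_aboveI2[where M = "max 0 (- m)"]) fastforce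
qed

lemma deficit_le_regulator1:
  assumes "lower_bounded x" "0 \<le> s" "s \<le> t"
  shows "max 0 (- x s) \<le> regulator1 x t"
  unfolding regulator1_def by (rule cSUP_upper) (use assms bdd_above_deficit in auto)

lemma regulator1_ge: "lower_bounded x \<Longrightarrow> 0 \<le> s \<Longrightarrow> s \<le> t \<Longrightarrow> - x s \<le> regulator1 x t"
  using deficit_le_regulator1[of x s t] by simp

lemma regulator1_nonneg: "lower_bounded x \<Longrightarrow> 0 \<le> t \<Longrightarrow> 0 \<le> regulator1 x t"
  using deficit_le_regulator1[of x t t] by simp

lemma regulator1_le:
  assumes "0 \<le> t" "0 \<le> B" "\<And>s. 0 \<le> s \<Longrightarrow> s \<le> t \<Longrightarrow> - x s \<le> B"
  shows "regulator1 x t \<le> B"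
  unfolding regulator1_def by (rule cSUP_least) (use assms in auto)

lemma regulator1_mono:
  assumes "lower_bounded x"
  shows "mono_on {0..} (regulator1 x)"
proof (rule mono_onI)
  fix s t :: real assume "s \<in> {0..}" "s \<le> t"
  with assms show "regulator1 x s \<le> regulator1 x t"
    by (intro regulator1_le regulator1_nonneg regulator1_ge) auto
qed

text \<open>Restarting the regulator at time \<open>s\<close>: a later increase is forced only by the path after \<open>s\<close>.\<close>
lemma regulator1_le_max:
  assumes "lower_bounded x" "0 \<le> s" "s \<le> t" "\<And>r. s < r \<Longrightarrow> r \<le> t \<Longrightarrow> - x r \<le> B"
  shows "regulator1 x t \<le> max (regulator1 x s) B"
proof (rule regulator1_le)
  fix r assume "0 \<le> r" "r \<le> t"
  then show "- x r \<le> max (regulator1 x s) B"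
    using assms(4)[of r] regulator1_ge[OF assms(1), of r s] by (cases "r \<le> s") auto
qed (use assms regulator1_nonneg[OF assms(1), of s] in auto)

lemma regulator1_perturb:
  assumes "lower_bounded y" "0 \<le> t" "0 \<le> B" "\<And>s. 0 \<le> s \<Longrightarrow> s \<le> t \<Longrightarrow> y s \<le> x s + B"
  shows "regulator1 x t \<le> regulator1 y t + B"
proof (rule regulator1_le)
  fix s assume "0 \<le> s" "s \<le> t"
  then show "- x s \<le> regulator1 y t + B"
    using assms(4)[of s] regulator1_ge[OF assms(1), of s t] by simp
qed (use assms regulator1_nonneg[OF assms(1,2)] in auto)

text \<open>If \<open>y - x\<close> is nonnegative and nondecreasing, then \<open>y\<close> falls below its past by no more than \<open>x\<close>
  does. Hence \<open>y\<close> is reflected to a higher level, and starting from a higher level with larger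
  increments it needs no more regulation over every time interval. The hypothesis on \<open>y - x\<close> has the
  same form as the conclusion on the regulators, so the comparison can be iterated.\<close>
lemma regulator1_comparison:
  assumes x: "lower_bounded x" and y: "lower_bounded y"
    and u: "mono_on {0..} (\<lambda>t. y t - x t)" "\<And>t. 0 \<le> t \<Longrightarrow> x t \<le> y t"
  shows reflected_le: "0 \<le> s \<Longrightarrow> x s + regulator1 x s \<le> y s + regulator1 y s"
    and mono_on_regulator1_diff: "mono_on {0..} (\<lambda>t. regulator1 x t - regulator1 y t)"
    and regulator1_antimono: "0 \<le> s \<Longrightarrow> regulator1 y s \<le> regulator1 x s"
proof -
  show le: "x s + regulator1 x s \<le> y s + regulator1 y s" if "0 \<le> s" for s
  proof -
    have "regulator1 x s \<le> regulator1 y s + (y s - x s)"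
      by (rule regulator1_perturb[OF y])
        (use that u(2)[OF that] monotone_onD[OF u(1), of _ s] in force)+
    then show ?thesis by simp
  qed
  show "mono_on {0..} (\<lambda>t. regulator1 x t - regulator1 y t)"
  proof (rule mono_onI)
    fix s t :: real assume st: "s \<in> {0..}" "s \<le> t"
    have "regulator1 y t \<le> max (regulator1 y s) (regulator1 x t - (y s - x s))"
    proof (rule regulator1_le_max[OF y])
      fix r assume "s < r" "r \<le> t"
      then show "- y r \<le> regulator1 x t - (y s - x s)"
        using st monotone_onD[OF u(1), of s r] regulator1_ge[OF x, of r t] by simp
    qed (use st in auto)
    then show "regulator1 x s - regulator1 y s \<le> regulator1 x t - regulator1 y t"
      using le[of s] st monotone_onD[OF regulator1_mono[OF x], of s t] by auto
  qed
  show "regulator1 y s \<le> regulator1 x s" if "0 \<le> s" for s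
    by (rule regulator1_le) (use that u(2) regulator1_nonneg[OF x] regulator1_ge[OF x] in \<open>force+\<close>)
qed

section \<open>Stieltjes measures and complementarity\<close>

definition regulating :: "(real \<Rightarrow> real) \<Rightarrow> bool" where
  "regulating l \<longleftrightarrow> mono_on {0..} l \<and> (\<forall>t\<ge>0. 0 \<le> l t) \<and> (\<forall>t\<ge>0. (l \<longlongrightarrow> l t) (at_right t))"

lemma regulating_extension:
  assumes "regulating l"
  defines "F \<equiv> \<lambda>t. if t < 0 then 0 else l t"
  shows "a \<le> b \<Longrightarrow> F a \<le> F b" and "continuous (at_right a) F"
proof -
  show "F a \<le> F b" if "a \<le> b"
    using assms that by (auto simp: regulating_def F_def monotone_on_def)
  show "continuous (at_right a) F"
  proof (cases "a < 0")
    case True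
    have "((\<lambda>_. 0) \<longlongrightarrow> 0) (at_right a)" by simp
    moreover have "\<forall>\<^sub>F s in at_right a. 0 = F s"
      using eventually_at_right[of a 0] True by (auto simp: F_def)
    ultimately show ?thesis
      unfolding continuous_within using True by (simp add: F_def filterlim_cong)
  next
    case False
    then have "(l \<longlongrightarrow> l a) (at_right a)" using assms by (simp add: regulating_def)
    moreover have "\<forall>\<^sub>F s in at_right a. l s = F s"
      using False by (auto simp: F_def eventually_at_filter)
    ultimately show ?thesis
      unfolding continuous_within using False by (simp add: F_def filterlim_cong)
  qed
qed

lemma emeasure_stieltjes_Ioc:
  assumes "regulating l" "a \<le> b" "0 \<le> b"
  shows "emeasure (stieltjes_measure l) {a<..b} = ennreal (l b - (if a < 0 then 0 else l a))"
  unfolding stieltjes_measure_def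
  using emeasure_interval_measure_Ioc[OF assms(2) regulating_extension[OF assms(1)]] assms(3)
  by simp

lemma sets_stieltjes [simp, measurable_cong]: "sets (stieltjes_measure l) = sets borel"
  by (simp add: stieltjes_measure_def)

text \<open>The mass of \<open>{a..b}\<close> is \<open>l b\<close> minus the left limit of \<open>l\<close> at \<open>a\<close>. Stating that it vanishes
  through the upper bounds \<open>m\<close> of the past avoids left limits, and the condition \<open>0 \<le> m\<close> takes
  care of the atom at \<open>0\<close>.\<close>
lemma emeasure_stieltjes_Icc_eq_0_iff:
  assumes l: "regulating l" and "0 \<le> a" "a \<le> b"
  shows "emeasure (stieltjes_measure l) {a..b} = 0 \<longleftrightarrow>
    (\<forall>m\<ge>0. (\<forall>r. 0 \<le> r \<and> r < a \<longrightarrow> l r \<le> m) \<longrightarrow> l b \<le> m)"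
    (is "emeasure ?M _ = 0 \<longleftrightarrow> ?R")
proof
  assume null: "emeasure ?M {a..b} = 0"
  show ?R
  proof (intro allI impI)
    fix m :: real assume m: "0 \<le> m" "\<forall>r. 0 \<le> r \<and> r < a \<longrightarrow> l r \<le> m"
    define A where "A n = {a - inverse (real (Suc n))<..b}" for n
    have "(\<lambda>n. emeasure ?M (A n)) \<longlonglongrightarrow> emeasure ?M (\<Inter>n. A n)"
    proof (rule Lim_emeasure_decseq)
      show "decseq A"
        unfolding A_def decseq_def
        by (auto intro!: le_imp_inverse_le  elim!: le_less_trans[rotated])
      show "emeasure ?M (A n) \<noteq> \<infinity>" for n
        unfolding A_def by (subst emeasure_stieltjes_Ioc[OF l]) (use assms in \<open>auto intro: order_trans[of _ a]\<close>)
    qed (auto simp: A_def)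
    also have "(\<Inter>n. A n) = {a..b}"
    proof -
      have "a \<le> s" if "\<And>n. a - inverse (real (Suc n)) < s" for s
        using reals_Archimedean[of "a - s"] that by (metis diff_gt_0_iff_gt less_diff_eq not_le 
            add.commute less_asym diff_less_eq)
      moreover have "a - inverse (real (Suc n)) < s" if "a \<le> s" for s n
        using that by (smt (verit) inverse_positive_iff_positive of_nat_0_less_iff zero_less_Suc)
      ultimately show ?thesis by (auto simp: A_def)
    qed
    finally have lim: "(\<lambda>n. emeasure ?M (A n)) \<longlonglongrightarrow> 0" using null by simp
    have "ennreal (l b - m) \<le> emeasure ?M (A n)" for n
    proof -
      let ?r = "a - inverse (real (Suc n))"
      have "?r < a" "?r \<le> b" using assms by (auto intro: order_trans[of _ a])
      then have "(if ?r < 0 then 0 else l ?r) \<le> m" using m by simp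
      then show ?thesis
        unfolding A_def using \<open>?r \<le> b\<close> assms
        by (subst emeasure_stieltjes_Ioc[OF l]) (auto intro!: ennreal_leI)
    qed
    then have "ennreal (l b - m) \<le> 0"
      using lim by (intro LIMSEQ_le_const) auto
    then show "l b \<le> m" by (simp add: ennreal_eq_0_iff)
  qed
next
  assume R: ?R
  define F where "F t = (if t < 0 then 0 else l t)" for t
  have "F r \<le> l b" if "r < a" for r
    using regulating_extension(1)[OF l, of r b] that assms by (simp add: F_def)
  then have bdd: "bdd_above (F ` {..<a})" by (intro bdd_aboveI2[where M = "l b"]) auto
  define m where "m = (SUP r\<in>{..<a}. F r)"
  have le: "F r \<le> m" if "r < a" for r
    unfolding m_def using that bdd by (intro cSUP_upper) auto
  have "0 \<le> m" using le[of "- 1"] assms by (simp add: F_def)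
  moreover have "l r \<le> m" if "0 \<le> r" "r < a" for r
    using le[of r] that by (simp add: F_def)
  ultimately have "l b \<le> m" using R by blast
  have "emeasure ?M {a..b} \<le> ennreal e" if "0 < e" for e
  proof -
    have "m - e < m" using that by simp
    then obtain r where r: "r < a" "m - e < F r"
      unfolding m_def using less_cSUP_iff[OF _ bdd] by (metis lessThan_iff lessThan_non_empty)
    have "emeasure ?M {a..b} \<le> emeasure ?M {r<..b}"
      by (rule emeasure_mono) (use r in auto)
    also have "\<dots> = ennreal (l b - F r)"
      using r assms by (simp add: emeasure_stieltjes_Ioc[OF l] F_def)
    also have "\<dots> \<le> ennreal e"
      using r \<open>l b \<le> m\<close> by (intro ennreal_leI) simp
    finally show ?thesis .
  qed
  then show "emeasure ?M {a..b} = 0"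
    by (metis ennreal_le_epsilon le_zero_eq add_0 ennreal_0)
qed

text \<open>The set of such left endpoints \<open>t\<close> may be uncountable, but it is closed under moving \<open>t\<close> to the
  right. Rational endpoints therefore exhaust it, up to its least element if there is one.\<close>
lemma null_left_endpoints:
  fixes M :: "real measure"
  assumes [simp]: "sets M = sets borel"
  shows "\<exists>N\<in>null_sets M. {t. t \<le> q \<and> emeasure M {t..q} = 0} \<subseteq> N"
proof -
  define E where "E = {t. t \<le> q \<and> emeasure M {t..q} = 0}"
  have up: "s \<in> E" if "t \<in> E" "t \<le> s" "s \<le> q" for s t
  proof -
    have "emeasure M {s..q} \<le> emeasure M {t..q}" using that by (intro emeasure_mono) auto
    then show ?thesis using that by (simp add: E_def)
  qed
  define N where "N = (\<Union>r\<in>\<rat> \<inter> E. {r..q}) \<union> {t \<in> E. \<forall>s\<in>E. t \<le> s}"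
  have "(\<Union>r\<in>\<rat> \<inter> E. {r..q}) \<in> null_sets M"
    by (intro null_sets_UN' countable_Int1 countable_rat) (auto simp: E_def null_sets_def)
  moreover have "{t \<in> E. \<forall>s\<in>E. t \<le> s} \<in> null_sets M"
  proof (cases "{t \<in> E. \<forall>s\<in>E. t \<le> s} = {}")
    case False
    then obtain t where t: "t \<in> E" "\<forall>s\<in>E. t \<le> s" by blast
    then have "{t \<in> E. \<forall>s\<in>E. t \<le> s} = {t}" by force
    moreover have "{t} \<in> null_sets M"
      by (rule null_sets_subset[of "{t..q}"]) (use t in \<open>auto simp: E_def null_sets_def\<close>)
    ultimately show ?thesis by simp
  qed (simp only: null_sets.empty_sets)
  ultimately have "N \<in> null_sets M" unfolding N_def by blast
  moreover have "E \<subseteq> N"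
  proof
    fix t assume t: "t \<in> E"
    show "t \<in> N"
    proof (cases "\<forall>s\<in>E. t \<le> s")
      case False
      then obtain s where s: "s \<in> E" "s < t" by force
      then obtain r where r: "r \<in> \<rat>" "s < r" "r < t" using Rats_dense_in_real by blast
      then have "r \<in> E" using s t up[of s r] by (auto simp: E_def)
      moreover have "t \<in> {r..q}" using r t by (simp add: E_def)
      ultimately show ?thesis using r unfolding N_def by blast
    qed (use t in \<open>simp add: N_def\<close>)
  qed
  ultimately show ?thesis unfolding E_def by blast
qed

definition complementary :: "(real \<Rightarrow> real) \<Rightarrow> (real \<Rightarrow> real) \<Rightarrow> bool" where
  "complementary w l \<longleftrightarrow>
    (\<integral>\<^sup>+ t\<in>{0..}. indicator {s. 0 < w s} t \<partial>stieltjes_measure l) = 0"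

lemma complementary_null:
  assumes "complementary w l" "A \<in> sets borel" "A \<subseteq> {0..}" "\<And>t. t \<in> A \<Longrightarrow> 0 < w t"
  shows "emeasure (stieltjes_measure l) A = 0"
proof -
  have "emeasure (stieltjes_measure l) A = (\<integral>\<^sup>+ t. indicator A t \<partial>stieltjes_measure l)"
    using assms(2) by simp
  also have "\<dots> \<le> (\<integral>\<^sup>+ t\<in>{0..}. indicator {s. 0 < w s} t \<partial>stieltjes_measure l)"
    by (rule nn_integral_mono) (use assms(3,4) in \<open>auto simp: indicator_def\<close>)
  finally show ?thesis using assms(1) by (simp add: complementary_def)
qed

text \<open>If \<open>w t > 0\<close>, then by right continuity \<open>- x\<close> stays below \<open>l t - w t / 2\<close> up to some rational
  time \<open>q > t\<close>. So \<open>l\<close> attains no new maximum of \<open>- x\<close> on \<open>{t..q}\<close>, not even at \<open>t\<close> itself,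
  and this interval has mass \<open>0\<close>. As only countably many \<open>q\<close> occur,
  a null set covers all times at which \<open>w\<close> is positive.\<close>
lemma complementary_regulator1:
  assumes x: "lower_bounded x" "\<And>t. 0 \<le> t \<Longrightarrow> (x \<longlongrightarrow> x t) (at_right t)"
    and l: "regulating l" "\<And>t. 0 \<le> t \<Longrightarrow> l t = regulator1 x t"
    and w: "\<And>t. 0 \<le> t \<Longrightarrow> w t = x t + l t"
  shows "complementary w l"
proof -
  let ?M = "stieltjes_measure l"
  define E where "E q = {t. t \<le> q \<and> emeasure ?M {t..q} = 0}" for q
  obtain N where N: "\<And>q. N q \<in> null_sets ?M" "\<And>q. E q \<subseteq> N q"
    using null_left_endpoints[of ?M] unfolding E_def by (metis sets_stieltjes)
  have cover: "\<exists>q\<in>\<rat>. t \<in> E q" if t: "0 \<le> t" "0 < w t" for t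
  proof -
    have "x t - w t / 2 < x t" using t by simp
    then obtain u where u: "t < u" "\<And>s. t < s \<Longrightarrow> s < u \<Longrightarrow> x t - w t / 2 < x s"
      using order_tendstoD(1)[OF x(2)[OF t(1)]] unfolding eventually_at_right_field by blast
    \<comment> \<open>Rationality of \<open>q\<close> is what makes the cover countable.\<close>
    obtain q where q: "q \<in> \<rat>" "t < q" "q < u" using Rats_dense_in_real u(1) by blast
    have "emeasure ?M {t..q} = 0"
      unfolding emeasure_stieltjes_Icc_eq_0_iff[OF l(1) t(1) less_imp_le[OF q(2)]]
    proof (intro allI impI)
      fix m :: real assume m: "0 \<le> m" "\<forall>r. 0 \<le> r \<and> r < t \<longrightarrow> l r \<le> m"
      have "regulator1 x q \<le> max m (l t - w t / 2)"
      proof (rule regulator1_le)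
        fix s assume s: "0 \<le> s" "s \<le> q"
        consider "s < t" | "s = t" | "t < s" by linarith
        then show "- x s \<le> max m (l t - w t / 2)"
        proof cases
          case 1
          then have "- x s \<le> m"
            using m(2) s regulator1_ge[OF x(1), of s s] l(2)[of s] by force
          then show ?thesis by simp
        next
          case 2
          then have "- x s \<le> l t - w t / 2" using w[OF t(1)] t(2) by (simp add: field_simps)
          then show ?thesis by simp
        next
          case 3
          then have "- x s \<le> l t - w t / 2" using w[OF t(1)] u(2)[of s] s q by (simp add: field_simps)
          then show ?thesis by simp
        qed
      qed (use t q m in auto)
      moreover have "l t \<le> l q"
        using l(1) t q by (auto simp: regulating_def monotone_on_def)
      ultimately show "l q \<le> m" using l(2)[of q] t q by auto
    qed
    then show ?thesis using q by (intro bexI[of _ q]) (auto simp: E_def)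
  qed
  have "(\<Union>q\<in>\<rat>. N q) \<in> null_sets ?M"
    by (intro null_sets_UN' countable_rat) (use N in auto)
  then have "emeasure ?M (\<Union>q\<in>\<rat>. N q) = 0" "(\<Union>q\<in>\<rat>. N q) \<in> sets ?M" by auto
  then have "(\<integral>\<^sup>+ t. indicator (\<Union>q\<in>\<rat>. N q) t \<partial>?M) = 0" by (subst nn_integral_indicator) auto
  moreover have "(\<integral>\<^sup>+ t\<in>{0..}. indicator {s. 0 < w s} t \<partial>?M)
      \<le> (\<integral>\<^sup>+ t. indicator (\<Union>q\<in>\<rat>. N q) t \<partial>?M)"
  proof (rule nn_integral_mono)
    fix t
    have "t \<in> (\<Union>q\<in>\<rat>. N q)" if "0 \<le> t" "0 < w t"
      using cover[OF that] N(2) by blast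
    then show "(indicator {s. 0 < w s} t :: ennreal) * indicator {0..} t \<le> indicator (\<Union>q\<in>\<rat>. N q) t"
      by (auto simp: indicator_def)
  qed
  ultimately show ?thesis by (simp add: complementary_def)
qed

text \<open>The formula is a lower bound for every admissible \<open>l\<close>. If \<open>l\<close> exceeded \<open>m = regulator1 x t\<close> at
  time \<open>t\<close>, then from the first passage \<open>\<tau>\<close> above \<open>m\<close> up to \<open>t\<close> the process \<open>w\<close> would be
  positive, so \<open>l\<close> could not have grown from below \<open>m\<close>.\<close>
lemma complementary_imp_regulator1:
  assumes x: "lower_bounded x"
    and l: "regulating l"
    and w: "\<And>t. 0 \<le> t \<Longrightarrow> w t = x t + l t" "\<And>t. 0 \<le> t \<Longrightarrow> 0 \<le> w t"
    and c: "complementary w l"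
    and t: "0 \<le> t"
  shows "l t = regulator1 x t"
proof (rule antisym)
  have l_mono: "l r \<le> l s" if "0 \<le> r" "r \<le> s" for r s
    using l that by (auto simp: regulating_def monotone_on_def)
  show "regulator1 x t \<le> l t"
  proof (rule regulator1_le[OF t])
    show "0 \<le> l t" using l t by (simp add: regulating_def)
    show "- x s \<le> l t" if "0 \<le> s" "s \<le> t" for s
      using w[of s] l_mono[of s t] that by simp
  qed
  show "l t \<le> regulator1 x t"
  proof (rule ccontr)
    assume "\<not> l t \<le> regulator1 x t"
    define m where "m = regulator1 x t"
    have m: "0 \<le> m" "m < l t" using \<open>\<not> l t \<le> regulator1 x t\<close> regulator1_nonneg[OF x t] by (auto simp: m_def)
    have pos: "0 < w s" if "0 \<le> s" "s \<le> t" "m < l s" for s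
      using w(1)[of s] regulator1_ge[OF x, of s t] that by (simp add: m_def)
    define S where "S = {s \<in> {0..t}. m < l s}"
    define \<tau> where "\<tau> = Inf S"
    have S: "t \<in> S" "bdd_below S" using m t by (auto simp: S_def)
    have \<tau>: "0 \<le> \<tau>" "\<tau> \<le> t"
      unfolding \<tau>_def using S by (auto intro!: cInf_greatest cInf_lower simp: S_def)
    have above: "m < l s" if s: "\<tau> < s" "s \<le> t" for s
    proof -
      obtain r where "r \<in> S" "r < s"
        using s(1) S(1) cInf_less_iff[OF _ S(2), of s] unfolding \<tau>_def by blast
      then show ?thesis using l_mono[of r s] s by (auto simp: S_def)
    qed
    have below: "l r \<le> m" if "0 \<le> r" "r < \<tau>" for r
      using that \<tau> cInf_lower[OF _ S(2), of r] unfolding \<tau>_def[symmetric] by (force simp: S_def)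
    have "emeasure (stieltjes_measure l) {\<tau><..t} = 0"
      by (rule complementary_null[OF c]) (use \<tau> above pos in auto)
    \<comment> \<open>Right continuity only gives \<open>m \<le> l \<tau>\<close>; the null interval makes it strict.\<close>
    then have "l t \<le> l \<tau>"
      using \<tau> by (simp add: emeasure_stieltjes_Ioc[OF l] ennreal_eq_0_iff)
    with m above have above': "m < l s" if "\<tau> \<le> s" "s \<le> t" for s
      using that by (cases "s = \<tau>") auto
    have "emeasure (stieltjes_measure l) {\<tau>..t} = 0"
      by (rule complementary_null[OF c]) (use \<tau> above' pos in auto)
    then have "l t \<le> m"
      using m(1) below unfolding emeasure_stieltjes_Icc_eq_0_iff[OF l \<tau>] by blast
    with m show False by simp
  qed
qed

section \<open>The multidimensional reflection problem as a fixed point equation\<close>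

text \<open>One-sided limits bound the path near every time, and compactness does the rest.\<close>
lemma lower_bounded_cadlag_nth:
  fixes X :: "real \<Rightarrow> real^'n"
  assumes "cadlag X"
  shows "lower_bounded (\<lambda>t. X t $ i)"
proof -
  have loc: "\<exists>d>0. bounded (X ` ({t - d<..<t + d} \<inter> {0..}))" if t: "0 \<le> t" for t
  proof -
    have bnd: "\<forall>\<^sub>F s in F. norm (X s) \<le> norm l + 1" if "(X \<longlongrightarrow> l) F" for l F
      using order_tendstoD(2)[OF tendsto_norm[OF that], of "norm l + 1"]
      by (auto elim: eventually_mono)
    obtain b where b: "t < b" "\<And>s. t < s \<Longrightarrow> s < b \<Longrightarrow> norm (X s) \<le> norm (X t) + 1"
      using bnd[of "X t" "at_right t"] assms t
      unfolding cadlag_def eventually_at_right_field by blast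
    obtain a C where a: "a < t" "\<And>s. a < s \<Longrightarrow> s < t \<Longrightarrow> 0 \<le> s \<Longrightarrow> norm (X s) \<le> C"
    proof (cases "t = 0")
      case True
      then show ?thesis by (intro that[of "t - 1" 0]) auto
    next
      case False
      with t assms have "\<exists>l. (X \<longlongrightarrow> l) (at_left t)" by (simp add: cadlag_def)
      then obtain l where "(X \<longlongrightarrow> l) (at_left t)" ..
      from bnd[OF this] show ?thesis
        unfolding eventually_at_left_field using that by blast
    qed
    have "norm (X s) \<le> max C (norm (X t) + 1)" if "a < s" "s < b" "0 \<le> s" for s
      using a(2)[of s] b(2)[of s] that by (cases s t rule: linorder_cases) auto
    then have "bounded (X ` ({t - min (t - a) (b - t)<..<t + min (t - a) (b - t)} \<inter> {0..}))"
      by (intro boundedI[where B = "max C (norm (X t) + 1)"]) auto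
    then show ?thesis
      using a(1) b(1) by (intro exI[of _ "min (t - a) (b - t)"]) auto
  qed
  have "bounded (X ` ({0..T} \<inter> {0..}))" if "0 \<le> T" for T
    using that
  proof (induction rule: Bolzano[where P = "\<lambda>a b. bounded (X ` ({a..b} \<inter> {0..}))"])
    case (trans a b c)
    then have "{a..c} \<inter> {0..} = ({a..b} \<inter> {0..}) \<union> ({b..c} \<inter> {0..})" by auto
    with trans show ?case by (simp add: image_Un)
  next
    case (local t)
    then obtain d where d: "d > 0" "bounded (X ` ({t - d<..<t + d} \<inter> {0..}))"
      using loc by auto
    then show ?case
      by (intro exI[of _ d]) (auto elim!: bounded_subset)
  qed
  then have "bounded (X ` {0..T})" for T
    by (cases "0 \<le> T") (simp_all add: Int_absorb2)
  then have "bounded ((\<lambda>t. X t $ i) ` {0..T})" for T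
    using bounded_component_cart[of "X ` {0..T}"] by (simp add: image_image)
  then show ?thesis
    by (simp add: lower_bounded_def bounded_imp_bdd_below)
qed


text \<open>With this path as input, coordinate \<open>i\<close> of the reflection problem with matrix \<open>I - Q\<close> is
  one-dimensional.\<close>
definition net_input :: "real^'n^'n \<Rightarrow> (real \<Rightarrow> real^'n) \<Rightarrow> (real \<Rightarrow> real^'n) \<Rightarrow> 'n \<Rightarrow> real \<Rightarrow> real" where
  "net_input Q X L i t = X t $ i - (Q *v L t) $ i"

primrec picard :: "real^'n^'n \<Rightarrow> (real \<Rightarrow> real^'n) \<Rightarrow> nat \<Rightarrow> real \<Rightarrow> real^'n" where
  "picard Q X 0 = (\<lambda>t. 0)"
| "picard Q X (Suc k) = (\<lambda>t. \<chi> i. regulator1 (net_input Q X (picard Q X k) i) t)"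

text \<open>The matrix \<open>Q\<close> stands for \<open>P\<^sup>T\<close>.\<close>
locale nonneg_routing =
  fixes Q :: "real^'n^'n"
  assumes Q_nonneg: "0 \<le> Q $ i $ j"
begin

lemma Q_mono: "(\<And>j. x $ j \<le> y $ j) \<Longrightarrow> (Q *v x) $ i \<le> (Q *v y) $ i"
  by (rule matrix_vector_mult_nth_mono) (auto simp: Q_nonneg)

lemma lower_bounded_net_input:
  assumes "cadlag X" and L: "\<And>j. mono_on {0..} (\<lambda>t. L t $ j)"
  shows "lower_bounded (net_input Q X L i)"
  unfolding lower_bounded_def
proof
  fix T
  obtain m where m: "\<And>s. s \<in> {0..T} \<Longrightarrow> m \<le> X s $ i"
    using lower_bounded_cadlag_nth[OF assms(1), of i] unfolding lower_bounded_def bdd_below_def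
    by (metis imageI)
  have "m - (Q *v L T) $ i \<le> net_input Q X L i s" if "s \<in> {0..T}" for s
    unfolding net_input_def
    using m[OF that] that by (intro diff_mono Q_mono) (auto intro: monotone_onD[OF L])
  then show "bdd_below (net_input Q X L i ` {0..T})" by (rule bdd_belowI2)
qed

lemma picard_mono_on:
  assumes "cadlag X"
  shows "mono_on {0..} (\<lambda>t. picard Q X k t $ j)"
proof (induction k arbitrary: j)
  case 0
  then show ?case by (simp add: monotone_on_def)
next
  case (Suc k)
  then show ?case using regulator1_mono[OF lower_bounded_net_input[OF assms Suc]] by simp
qed

lemma lower_bounded_picard:
  "cadlag X \<Longrightarrow> lower_bounded (net_input Q X (picard Q X k) i)"
  by (intro lower_bounded_net_input picard_mono_on)

lemma picard_nonneg: "cadlag X \<Longrightarrow> 0 \<le> t \<Longrightarrow> 0 \<le> picard Q X k t $ j"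
  by (cases k) (auto intro: regulator1_nonneg lower_bounded_picard)

lemma picard_le_Suc:
  assumes "cadlag X" "0 \<le> t"
  shows "picard Q X k t $ j \<le> picard Q X (Suc k) t $ j"
  using assms(2)
proof (induction k arbitrary: t j)
  case 0
  then show ?case using picard_nonneg[OF assms(1), of t "Suc 0" j] by simp
next
  case (Suc k)
  have "regulator1 (net_input Q X (picard Q X k) j) t \<le> regulator1 (net_input Q X (picard Q X (Suc k)) j) t + 0"
    by (rule regulator1_perturb[OF lower_bounded_picard[OF assms(1)]])
      (use Suc in \<open>auto simp: net_input_def simp del: picard.simps intro!: Q_mono\<close>)
  then show ?case by simp
qed

text \<open>Solving each coordinate by the one-dimensional theory turns the Skorohod problem into a fixed point
  equation for the regulator.\<close>
lemma skorohod_solution_iff: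
  assumes X: "cadlag X"
  shows "skorohod_solution (mat 1 - Q) X W L \<longleftrightarrow>
    (\<forall>t\<ge>0. \<forall>i. W t $ i = net_input Q X L i t + L t $ i) \<and> (\<forall>i. regulating (\<lambda>t. L t $ i)) \<and>
    (\<forall>i. \<forall>t\<ge>0. L t $ i = regulator1 (net_input Q X L i) t)" (is "?S \<longleftrightarrow> ?W \<and> ?G \<and> ?F")
proof -
  have S: "?S \<longleftrightarrow> ?W \<and> ?G \<and> (\<forall>i. \<forall>t\<ge>0. 0 \<le> W t $ i) \<and> (\<forall>i. complementary (\<lambda>t. W t $ i) (\<lambda>t. L t $ i))"
    unfolding skorohod_solution_def regulating_def complementary_def net_input_def
    by (auto simp: vec_eq_iff matrix_vector_mult_diff_rdistrib algebra_simps)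
  have lb: "lower_bounded (net_input Q X L i)" if ?G for i
    by (rule lower_bounded_net_input[OF X]) (use that in \<open>simp add: regulating_def\<close>)
  show ?thesis
  proof
    assume ?S
    with S have *: ?W ?G "\<forall>i. \<forall>t\<ge>0. 0 \<le> W t $ i" "\<forall>i. complementary (\<lambda>t. W t $ i) (\<lambda>t. L t $ i)"
      by auto
    have ?F
    proof (intro allI impI)
      fix i t assume "(0::real) \<le> t"
      with * show "L t $ i = regulator1 (net_input Q X L i) t"
        by (intro complementary_imp_regulator1[of _ "\<lambda>t. L t $ i" "\<lambda>t. W t $ i"] lb) auto
    qed
    with * show "?W \<and> ?G \<and> ?F" by blast
  next
    assume *: "?W \<and> ?G \<and> ?F"
    have rc: "((\<lambda>s. net_input Q X L i s) \<longlongrightarrow> net_input Q X L i t) (at_right t)" if "0 \<le> t" for i t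
      unfolding net_input_def matrix_vector_mult_def vec_lambda_beta
    proof (intro tendsto_diff tendsto_sum tendsto_mult tendsto_const)
      show "((\<lambda>s. X s $ i) \<longlongrightarrow> X t $ i) (at_right t)"
        using X that by (intro tendsto_vec_nth) (simp add: cadlag_def)
      show "((\<lambda>s. L s $ j) \<longlongrightarrow> L t $ j) (at_right t)" for j
        using * that unfolding regulating_def by blast
    qed
    have "complementary (\<lambda>t. W t $ i) (\<lambda>t. L t $ i)" for i
      by (rule complementary_regulator1[OF lb rc]) (use * in auto)
    moreover have "0 \<le> W t $ i" if "0 \<le> t" for i t
      using regulator1_ge[OF lb, of t t i] * that by simp
    ultimately show ?S using S * by blast
  qed
qed

end

section \<open>Existence, uniqueness and the maximum principle\<close>

text \<open>The vector \<open>v\<close> is \<open>(I - Q)\<^sup>-\<^sup>1 (1, \<dots>, 1)\<close>; as a weight it makes \<open>Q\<close> a strict contraction for the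
  maximum norm.\<close>
locale contractive_routing = nonneg_routing +
  fixes v :: "real^'n"
  assumes v_nonneg: "0 \<le> v $ i" and v_eq: "v $ i = 1 + (Q *v v) $ i"
begin

lemma v_ge_1: "1 \<le> v $ i"
  using Q_mono[of 0 v i] v_nonneg v_eq[of i] by simp

text \<open>Look at a coordinate \<open>k\<close> where \<open>d $ k / v $ k\<close> attains its maximum \<open>c\<close>: there
  \<open>c v\<^sub>k \<le> c (Q v)\<^sub>k + e = c (v\<^sub>k - 1) + e\<close>, that is \<open>c \<le> e\<close>. This one estimate gives
  boundedness of the iterates, right continuity of their limit, uniqueness, and the bound on the
  effect of a shift.\<close>
lemma max_principle:
  assumes "\<And>i. d $ i \<le> (Q *v d) $ i + e"
  shows "d $ i \<le> e * v $ i"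
proof -
  have vpos: "0 < v $ j" for j using v_ge_1[of j] by simp
  have "Max (range (\<lambda>i. d $ i / v $ i)) \<in> range (\<lambda>i. d $ i / v $ i)"
    by (rule Max_in) auto
  then obtain k where k: "Max (range (\<lambda>i. d $ i / v $ i)) = d $ k / v $ k" by blast
  define c where "c = d $ k / v $ k"
  have "d $ j / v $ j \<le> c" for j
    unfolding c_def k[symmetric] by (rule Max_ge) auto
  then have le: "d $ j \<le> (c *\<^sub>R v) $ j" for j
    using vpos[of j] by (simp add: divide_le_eq)
  have "c * v $ k = d $ k" using vpos[of k] by (simp add: c_def)
  also have "\<dots> \<le> (Q *v (c *\<^sub>R v)) $ k + e"
    using assms[of k] Q_mono[of d "c *\<^sub>R v", OF le, of k] by simp
  also have "\<dots> = c * (v $ k - 1) + e"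
    using v_eq[of k] by (simp add: matrix_vector_mult_scaleR)
  finally have "c \<le> e" by (simp add: algebra_simps)
  with le[of i] show ?thesis
    using mult_right_mono[OF \<open>c \<le> e\<close> v_nonneg[of i]] by simp
qed

text \<open>As the iterates increase, each of them satisfies \<open>L \<le> Q L + K\<close> at time \<open>t\<close>, where \<open>K\<close> bounds
  \<open>- X\<close> up to that time.\<close>
lemma picard_bounded:
  assumes X: "cadlag X" and t: "0 \<le> t"
  shows "\<exists>B. \<forall>k. picard Q X k t $ j \<le> B"
proof -
  have "\<exists>m. \<forall>s\<in>{0..t}. m \<le> X s $ i" for i
    using lower_bounded_cadlag_nth[OF X, of i] unfolding lower_bounded_def bdd_below_def by blast
  then obtain m where m: "\<And>i s. s \<in> {0..t} \<Longrightarrow> m i \<le> X s $ i" by metis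
  define K where "K = (\<Sum>i\<in>UNIV. \<bar>m i\<bar>)"
  have K: "- X s $ i \<le> K" if "s \<in> {0..t}" for s i
  proof -
    have "- X s $ i \<le> \<bar>m i\<bar>" using m[OF that, of i] by simp
    also have "\<dots> \<le> K" unfolding K_def by (rule member_le_sum) auto
    finally show ?thesis .
  qed
  have "0 \<le> K" by (simp add: K_def sum_nonneg)
  have "picard Q X k t $ j \<le> K * v $ j" for k
  proof (rule max_principle)
    fix i
    let ?L = "picard Q X k"
    have Q0: "0 \<le> (Q *v ?L t) $ i"
      using Q_mono[of 0 "?L t" i] picard_nonneg[OF X t] by simp
    have "?L t $ i \<le> regulator1 (net_input Q X ?L i) t"
      using picard_le_Suc[OF X t, of k i] by simp
    also have "\<dots> \<le> (Q *v ?L t) $ i + K"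
    proof (rule regulator1_le[OF t])
      fix s assume s: "0 \<le> s" "s \<le> t"
      have "(Q *v ?L s) $ i \<le> (Q *v ?L t) $ i"
        by (rule Q_mono) (use s in \<open>auto intro: monotone_onD[OF picard_mono_on[OF X]]\<close>)
      then show "- net_input Q X ?L i s \<le> (Q *v ?L t) $ i + K"
        using K[of s i] s by (simp add: net_input_def)
    qed (use Q0 \<open>0 \<le> K\<close> in simp)
    finally show "?L t $ i \<le> (Q *v ?L t) $ i + K" .
  qed
  then show ?thesis by blast
qed

text \<open>The limit of the increasing iterates is a fixed point. A limit of an increasing sequence of right
  continuous monotone functions need not be right continuous; here it is, because the increment \<open>d\<close>
  of the limit over a short interval to the right of \<open>t\<close> satisfies \<open>d \<le> Q d + e\<close>.\<close>
lemma solution_exists: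
  assumes X: "cadlag X"
  obtains W L where "skorohod_solution (mat 1 - Q) X W L"
    and "\<And>t i. 0 \<le> t \<Longrightarrow> (\<lambda>k. picard Q X k t $ i) \<longlonglongrightarrow> L t $ i"
proof -
  define L where "L t = (\<chi> i. lim (\<lambda>k. picard Q X k t $ i))" for t
  have conv: "(\<lambda>k. picard Q X k t $ i) \<longlonglongrightarrow> L t $ i"
    and up: "picard Q X k t $ i \<le> L t $ i" if t: "0 \<le> t" for t i k
  proof -
    have inc: "incseq (\<lambda>k. picard Q X k t $ i)"
      by (rule incseq_SucI) (rule picard_le_Suc[OF X t])
    obtain B where "\<forall>k. picard Q X k t $ i \<le> B" using picard_bounded[OF X t] by blast
    then have "convergent (\<lambda>k. picard Q X k t $ i)"
      using incseq_convergent[OF inc] by (metis convergentI)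
    then show conv: "(\<lambda>k. picard Q X k t $ i) \<longlonglongrightarrow> L t $ i"
      by (simp add: L_def convergent_LIMSEQ_iff)
    show "picard Q X k t $ i \<le> L t $ i"
      by (rule incseq_le[OF inc conv])
  qed
  have nonneg: "0 \<le> L t $ i" if "0 \<le> t" for t i
    using up[OF that, of 0] by simp
  have mono: "mono_on {0..} (\<lambda>t. L t $ i)" for i
  proof (rule mono_onI)
    fix s t :: real assume st: "s \<in> {0..}" "t \<in> {0..}" "s \<le> t"
    have "picard Q X k s $ i \<le> picard Q X k t $ i" for k
      using monotone_onD[OF picard_mono_on[OF X] st] .
    then show "L s $ i \<le> L t $ i"
      using st by (intro LIMSEQ_le[OF conv conv]) auto
  qed
  have lb: "lower_bounded (net_input Q X L i)" for i
    by (rule lower_bounded_net_input[OF X mono])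
  have fixpt: "L t $ i = regulator1 (net_input Q X L i) t" if t: "0 \<le> t" for t i
  proof (rule antisym)
    have "picard Q X k t $ i \<le> regulator1 (net_input Q X L i) t" for k
    proof (cases k)
      case 0
      then show ?thesis using regulator1_nonneg[OF lb t] by simp
    next
      case (Suc k)
      have "regulator1 (net_input Q X (picard Q X k) i) t \<le> regulator1 (net_input Q X L i) t + 0"
        by (rule regulator1_perturb[OF lb t]) (auto simp: net_input_def intro!: Q_mono up)
      then show ?thesis using Suc by simp
    qed
    then show "L t $ i \<le> regulator1 (net_input Q X L i) t"
      by (intro LIMSEQ_le_const2[OF conv[OF t]]) auto
    show "regulator1 (net_input Q X L i) t \<le> L t $ i"
    proof (rule regulator1_le[OF t nonneg[OF t]])
      fix s assume s: "0 \<le> s" "s \<le> t"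
      have "(\<lambda>k. - net_input Q X (picard Q X k) i s) \<longlonglongrightarrow> - net_input Q X L i s"
        unfolding net_input_def matrix_vector_mult_def vec_lambda_beta
        by (intro tendsto_intros conv s)
      moreover have "- net_input Q X (picard Q X k) i s \<le> L t $ i" for k
        using regulator1_ge[OF lower_bounded_picard[OF X] s, of k i] up[OF t, of "Suc k" i] by simp
      ultimately show "- net_input Q X L i s \<le> L t $ i"
        by (intro LIMSEQ_le_const2) auto
    qed
  qed
  have rc: "((\<lambda>s. L s $ i) \<longlongrightarrow> L t $ i) (at_right t)" if t: "0 \<le> t" for t i
  proof (rule tendstoI)
    fix \<epsilon> :: real assume "0 < \<epsilon>"
    \<comment> \<open>The maximum principle costs a factor \<open>v $ i\<close>.\<close>
    define e where "e = \<epsilon> / (2 * v $ i)"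
    have "0 < e" "e * v $ i < \<epsilon>" using \<open>0 < \<epsilon>\<close> v_ge_1[of i] by (auto simp: e_def)
    have "\<forall>\<^sub>F s in at_right t. \<forall>j. X t $ j - e < X s $ j"
    proof (rule eventually_all_finite)
      fix j
      have "((\<lambda>s. X s $ j) \<longlongrightarrow> X t $ j) (at_right t)"
        using X t by (intro tendsto_vec_nth) (auto simp: cadlag_def)
      then show "\<forall>\<^sub>F s in at_right t. X t $ j - e < X s $ j"
        by (rule order_tendstoD) (use \<open>0 < e\<close> in simp)
    qed
    then obtain b where b: "t < b" "\<And>s j. t < s \<Longrightarrow> s < b \<Longrightarrow> X t $ j - e < X s $ j"
      unfolding eventually_at_right_field by blast
    have "\<bar>L s $ i - L t $ i\<bar> < \<epsilon>" if s: "t < s" "s < b" for s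
    proof -
      have incr: "0 \<le> (L s - L t) $ j" for j
        using monotone_onD[OF mono[of j], of t s] s t by simp
      have "(L s - L t) $ i \<le> e * v $ i"
      proof (rule max_principle)
        fix j
        have Q0: "0 \<le> (Q *v (L s - L t)) $ j"
          using Q_mono[of 0 "L s - L t" j] incr by simp
        have "regulator1 (net_input Q X L j) s
            \<le> max (regulator1 (net_input Q X L j) t) (L t $ j + (Q *v (L s - L t)) $ j + e)"
        proof (rule regulator1_le_max[OF lb t])
          fix r assume r: "t < r" "r \<le> s"
          have "(Q *v L r) $ j \<le> (Q *v L s) $ j"
            by (rule Q_mono) (use r t in \<open>auto intro: monotone_onD[OF mono]\<close>)
          moreover have "- net_input Q X L j t \<le> L t $ j"
            using regulator1_ge[OF lb t, of t j] fixpt[OF t, of j] by simp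
          ultimately show "- net_input Q X L j r \<le> L t $ j + (Q *v (L s - L t)) $ j + e"
            using b(2)[of r j] r s
            by (simp add: net_input_def matrix_vector_mult_diff_distrib)
        qed (use s in auto)
        then show "(L s - L t) $ j \<le> (Q *v (L s - L t)) $ j + e"
          using fixpt[OF t, of j] fixpt[of s j] s t Q0 \<open>0 < e\<close> by simp
      qed
      then show ?thesis using incr[of i] \<open>e * v $ i < \<epsilon>\<close> by simp
    qed
    then show "\<forall>\<^sub>F s in at_right t. dist (L s $ i) (L t $ i) < \<epsilon>"
      unfolding eventually_at_right_field dist_real_def using b(1) by blast
  qed
  have "skorohod_solution (mat 1 - Q) X (\<lambda>t. \<chi> i. net_input Q X L i t + L t $ i) L"
    unfolding skorohod_solution_iff[OF X] regulating_def
    using mono nonneg rc fixpt by auto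
  then show thesis using conv that by blast
qed

text \<open>The largest coordinatewise distance \<open>E\<close> of two regulators up to time \<open>T\<close> satisfies
  \<open>E \<le> Q E\<close>.\<close>
lemma solution_unique:
  assumes X: "cadlag X"
    and sol: "skorohod_solution (mat 1 - Q) X W L" "skorohod_solution (mat 1 - Q) X W' L'"
    and "0 \<le> T"
  shows "L T = L' T"
proof -
  note sol = sol[unfolded skorohod_solution_iff[OF X]]
  have mono: "mono_on {0..} (\<lambda>t. L t $ j)" "mono_on {0..} (\<lambda>t. L' t $ j)" for j
    using sol by (auto simp: regulating_def)
  have nonneg: "0 \<le> L t $ j" "0 \<le> L' t $ j" if "0 \<le> t" for t j
    using sol that by (auto simp: regulating_def)
  define E where "E = (\<chi> j. SUP t\<in>{0..T}. \<bar>L t $ j - L' t $ j\<bar>)"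
  have bdd: "bdd_above ((\<lambda>t. \<bar>L t $ j - L' t $ j\<bar>) ` {0..T})" for j
  proof (rule bdd_aboveI2)
    fix t assume "t \<in> {0..T}"
    then show "\<bar>L t $ j - L' t $ j\<bar> \<le> L T $ j + L' T $ j"
      using nonneg[of t j] nonneg[of T j]
        monotone_onD[OF mono(1), of t T j] monotone_onD[OF mono(2), of t T j]
      by (auto simp: abs_le_iff)
  qed
  have E: "\<bar>L t $ j - L' t $ j\<bar> \<le> E $ j" if "t \<in> {0..T}" for t j
    unfolding E_def vec_lambda_beta by (rule cSUP_upper[OF that bdd])
  have E0: "0 \<le> E $ j" for j
    using E[of 0 j] \<open>0 \<le> T\<close> by (auto intro: order_trans[rotated])
  have "E $ j \<le> (Q *v E) $ j + 0" for j
    unfolding E_def vec_lambda_beta add_0_right unfolding E_def[symmetric]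
  proof (rule cSUP_least)
    show "\<bar>L t $ j - L' t $ j\<bar> \<le> (Q *v E) $ j" if t: "t \<in> {0..T}" for t
    proof -
      have le: "(Q *v (L s - L' s)) $ j \<le> (Q *v E) $ j" "(Q *v (L' s - L s)) $ j \<le> (Q *v E) $ j"
        if "s \<in> {0..T}" for s
        using E[OF that] by (auto intro!: Q_mono simp: abs_le_iff)
      have lb: "lower_bounded (net_input Q X L j)" "lower_bounded (net_input Q X L' j)"
        by (intro lower_bounded_net_input X mono)+
      have "0 \<le> (Q *v E) $ j" using Q_mono[of 0 E j] E0 by simp
      have "regulator1 (net_input Q X L j) t \<le> regulator1 (net_input Q X L' j) t + (Q *v E) $ j"
      proof (rule regulator1_perturb[OF lb(2) _ \<open>0 \<le> (Q *v E) $ j\<close>])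
        fix s assume "0 \<le> s" "s \<le> t"
        with t show "net_input Q X L' j s \<le> net_input Q X L j s + (Q *v E) $ j"
          using le(1)[of s] by (simp add: net_input_def matrix_vector_mult_diff_distrib)
      qed (use t in simp)
      moreover have "regulator1 (net_input Q X L' j) t \<le> regulator1 (net_input Q X L j) t + (Q *v E) $ j"
      proof (rule regulator1_perturb[OF lb(1) _ \<open>0 \<le> (Q *v E) $ j\<close>])
        fix s assume "0 \<le> s" "s \<le> t"
        with t show "net_input Q X L j s \<le> net_input Q X L' j s + (Q *v E) $ j"
          using le(2)[of s] by (simp add: net_input_def matrix_vector_mult_diff_distrib)
      qed (use t in simp)
      moreover have "L t $ j = regulator1 (net_input Q X L j) t" "L' t $ j = regulator1 (net_input Q X L' j) t"
        using sol t by auto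
      ultimately show ?thesis by (simp add: abs_le_iff)
    qed
  qed (use \<open>0 \<le> T\<close> in auto)
  then have "E $ j \<le> 0" for j using max_principle[of E 0 j] by simp
  then have "L T $ j = L' T $ j" for j
    using E[of T j] \<open>0 \<le> T\<close> order_trans[of "\<bar>L T $ j - L' T $ j\<bar>" "E $ j" 0] by simp
  then show ?thesis by (simp add: vec_eq_iff)
qed

lemma picard_tendsto_solution:
  assumes "cadlag X" "skorohod_solution (mat 1 - Q) X W L" "0 \<le> t"
  shows "(\<lambda>k. picard Q X k t $ i) \<longlonglongrightarrow> L t $ i"
  using solution_exists[OF assms(1)] solution_unique[OF assms(1,2) _ assms(3)] assms(3) by metis

section \<open>Monotone dependence on the initial state\<close>

text \<open>Adding \<open>a\<close> raises the net inputs by \<open>a\<close> plus \<open>Q\<close> times the difference of the iterates, which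
  is nonnegative and nondecreasing by induction; the one-dimensional comparison closes the step.\<close>
lemma picard_shift:
  fixes a :: "real^'n"
  assumes X: "cadlag X" "cadlag (\<lambda>s. a + X s)" and a: "\<And>j. 0 \<le> a $ j"
  shows "mono_on {0..} (\<lambda>t. picard Q X k t $ j - picard Q (\<lambda>s. a + X s) k t $ j) \<and>
    (\<forall>t\<ge>0. picard Q (\<lambda>s. a + X s) k t $ j \<le> picard Q X k t $ j)"
proof (induction k arbitrary: j)
  case 0
  then show ?case by (simp add: monotone_on_def)
next
  case (Suc k)
  let ?L = "picard Q X k" and ?L' = "picard Q (\<lambda>s. a + X s) k"
  have gap: "net_input Q (\<lambda>s. a + X s) ?L' j t - net_input Q X ?L j t = a $ j + (Q *v (?L t - ?L' t)) $ j" for t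
    by (simp add: net_input_def matrix_vector_mult_diff_distrib)
  have lb: "lower_bounded (net_input Q X ?L j)" "lower_bounded (net_input Q (\<lambda>s. a + X s) ?L' j)"
    by (intro lower_bounded_picard X)+
  have "mono_on {0..} (\<lambda>t. net_input Q (\<lambda>s. a + X s) ?L' j t - net_input Q X ?L j t)"
    unfolding gap
  proof (rule mono_onI)
    fix s t :: real assume st: "s \<in> {0..}" "t \<in> {0..}" "s \<le> t"
    have "(?L s - ?L' s) $ i \<le> (?L t - ?L' t) $ i" for i
      using monotone_onD[OF conjunct1[OF Suc] st] by simp
    then show "a $ j + (Q *v (?L s - ?L' s)) $ j \<le> a $ j + (Q *v (?L t - ?L' t)) $ j"
      by (intro add_left_mono Q_mono)
  qed
  moreover have "net_input Q X ?L j t \<le> net_input Q (\<lambda>s. a + X s) ?L' j t" if "0 \<le> t" for t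
  proof -
    have "0 \<le> (Q *v (?L t - ?L' t)) $ j"
      using Q_mono[of 0 "?L t - ?L' t" j] Suc that by simp
    then show ?thesis using gap[of t] a[of j] by simp
  qed
  ultimately show ?case
    using mono_on_regulator1_diff[OF lb] regulator1_antimono[OF lb] by simp
qed

text \<open>The comparison of the iterates survives the limit. The reflected processes are then compared by
  the one-dimensional result, applied to the fixed point equations of \<open>L\<close> and \<open>L'\<close>.\<close>
lemma solution_shift:
  fixes a :: "real^'n"
  assumes X: "cadlag X" "cadlag (\<lambda>s. a + X s)" and a: "\<And>j. 0 \<le> a $ j"
    and sol: "skorohod_solution (mat 1 - Q) X W L"
      "skorohod_solution (mat 1 - Q) (\<lambda>s. a + X s) W' L'"
  shows mono_on_regulator_diff: "mono_on {0..} (\<lambda>t. L t $ j - L' t $ j)"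
    and regulator_antimono: "0 \<le> t \<Longrightarrow> L' t $ j \<le> L t $ j"
    and reflected_shift_mono: "0 \<le> t \<Longrightarrow> W t $ j \<le> W' t $ j"
    and reflected_diff: "0 \<le> t \<Longrightarrow>
      W' t $ j - W t $ j = a $ j + (Q *v (L t - L' t)) $ j - (L t - L' t) $ j"
proof -
  have lim: "(\<lambda>k. picard Q X k t $ j) \<longlonglongrightarrow> L t $ j"
      "(\<lambda>k. picard Q (\<lambda>s. a + X s) k t $ j) \<longlonglongrightarrow> L' t $ j" if "0 \<le> t" for t j
    using picard_tendsto_solution[OF X(1) sol(1) that] picard_tendsto_solution[OF X(2) sol(2) that] by auto
  show mono: "mono_on {0..} (\<lambda>t. L t $ j - L' t $ j)" for j
  proof (rule mono_onI)
    fix s t :: real assume st: "s \<in> {0..}" "t \<in> {0..}" "s \<le> t"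
    have "picard Q X k s $ j - picard Q (\<lambda>s. a + X s) k s $ j
        \<le> picard Q X k t $ j - picard Q (\<lambda>s. a + X s) k t $ j" for k
      using monotone_onD[OF conjunct1[OF picard_shift[OF X a]] st] .
    then show "L s $ j - L' s $ j \<le> L t $ j - L' t $ j"
      using st by (intro LIMSEQ_le[OF tendsto_diff tendsto_diff, OF lim lim]) auto
  qed
  show le: "L' t $ j \<le> L t $ j" if "0 \<le> t" for t j
    using picard_shift[OF X a] that by (intro LIMSEQ_le[OF lim(2) lim(1)]) auto
  note sol = sol(1)[unfolded skorohod_solution_iff[OF X(1)]] sol(2)[unfolded skorohod_solution_iff[OF X(2)]]
  show diff: "W' t $ j - W t $ j = a $ j + (Q *v (L t - L' t)) $ j - (L t - L' t) $ j" if "0 \<le> t" for t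
    using sol that by (simp add: net_input_def matrix_vector_mult_diff_distrib)
  have gap: "net_input Q (\<lambda>s. a + X s) L' j t - net_input Q X L j t = a $ j + (Q *v (L t - L' t)) $ j" for t
    by (simp add: net_input_def matrix_vector_mult_diff_distrib)
  have lb: "lower_bounded (net_input Q X L j)" "lower_bounded (net_input Q (\<lambda>s. a + X s) L' j)"
    using sol by (auto intro!: lower_bounded_net_input X simp: regulating_def)
  show "W t $ j \<le> W' t $ j" if "0 \<le> t"
  proof -
    have "mono_on {0..} (\<lambda>t. net_input Q (\<lambda>s. a + X s) L' j t - net_input Q X L j t)"
      unfolding gap
    proof (rule mono_onI)
      fix s t :: real assume st: "s \<in> {0..}" "t \<in> {0..}" "s \<le> t"
      have "(L s - L' s) $ i \<le> (L t - L' t) $ i" for i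
        using monotone_onD[OF mono st] by simp
      then show "a $ j + (Q *v (L s - L' s)) $ j \<le> a $ j + (Q *v (L t - L' t)) $ j"
        by (intro add_left_mono Q_mono)
    qed
    moreover have "net_input Q X L j t \<le> net_input Q (\<lambda>s. a + X s) L' j t" if "0 \<le> t" for t
    proof -
      have "0 \<le> (Q *v (L t - L' t)) $ j"
        using Q_mono[of 0 "L t - L' t" j] le[OF that] by simp
      then show ?thesis using gap[of t] a[of j] by simp
    qed
    ultimately show ?thesis
      using reflected_le[OF lb _ _ that] sol that by simp
  qed
qed

text \<open>As the shifted reflected process is the larger one, \<open>d = L - L'\<close> satisfies
  \<open>d \<le> Q d + a\<close>; the sum of the \<open>a $ k\<close> is a common bound for the coordinates of \<open>a\<close>.\<close>
lemma regulator_diff_bounded: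
  fixes a :: "real^'n"
  assumes X: "cadlag X" "cadlag (\<lambda>s. a + X s)" and a: "\<And>j. 0 \<le> a $ j"
    and sol: "skorohod_solution (mat 1 - Q) X W L"
      "skorohod_solution (mat 1 - Q) (\<lambda>s. a + X s) W' L'"
    and "0 \<le> t"
  shows "L t $ j - L' t $ j \<le> (\<Sum>k\<in>UNIV. a $ k) * v $ j"
proof -
  have "(L t - L' t) $ i \<le> (Q *v (L t - L' t)) $ i + (\<Sum>k\<in>UNIV. a $ k)" for i
    using reflected_shift_mono[OF assms, of i] reflected_diff[OF assms, of i]
      member_le_sum[of i UNIV "\<lambda>k. a $ k"] a by simp
  from max_principle[OF this, of j] show ?thesis by simp
qed

end

section \<open>Asymptotic irrelevance of the initial state\<close>

lemma cadlag_shift: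
  fixes X :: "real \<Rightarrow> real^'n"
  assumes "cadlag X"
  shows "cadlag (\<lambda>s. a + X s)"
  unfolding cadlag_def
proof (intro conjI allI impI)
  show "((\<lambda>s. a + X s) \<longlongrightarrow> a + X t) (at_right t)" if "0 \<le> t" for t
    using assms that by (intro tendsto_add tendsto_const) (simp add: cadlag_def)
  show "\<exists>l. ((\<lambda>s. a + X s) \<longlongrightarrow> l) (at_left t)" if "0 < t" for t
  proof -
    have "\<exists>l. (X \<longlongrightarrow> l) (at_left t)" using assms that by (simp add: cadlag_def)
    then obtain l where "(X \<longlongrightarrow> l) (at_left t)" ..
    from tendsto_add[OF tendsto_const this] show ?thesis by (rule exI)
  qed
qed

lemma mono_on_at_top_iff_unbounded:
  fixes f :: "real \<Rightarrow> real"
  assumes "mono_on {0..} f"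
  shows "filterlim f at_top at_top \<longleftrightarrow> (\<forall>B. \<exists>t\<ge>0. B \<le> f t)"
proof
  assume "filterlim f at_top at_top"
  then have "\<forall>\<^sub>F t in at_top. 0 \<le> t \<and> B \<le> f t" for B
    using eventually_ge_at_top[of 0] by (intro eventually_conj) (auto simp: filterlim_at_top)
  from eventually_happens'[OF trivial_limit_at_top_linorder this]
  show "\<forall>B. \<exists>t\<ge>0. B \<le> f t" by blast
next
  assume ub: "\<forall>B. \<exists>t\<ge>0. B \<le> f t"
  show "filterlim f at_top at_top"
    unfolding filterlim_at_top
  proof
    fix B
    obtain t where t: "t \<ge> 0" "B \<le> f t" using ub by blast
    have "B \<le> f s" if "t \<le> s" for s
      using t that monotone_onD[OF assms, of t s] by simp
    then show "\<forall>\<^sub>F s in at_top. B \<le> f s" by (auto simp: eventually_at_top_linorder)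
  qed
qed

lemma mono_on_bounded_convergent:
  fixes f :: "real \<Rightarrow> real"
  assumes "mono_on {0..} f" "\<And>t. 0 \<le> t \<Longrightarrow> f t \<le> B"
  shows "\<exists>l. (f \<longlongrightarrow> l) at_top"
proof -
  define l where "l = (SUP t\<in>{0..}. f t)"
  have bdd: "bdd_above (f ` {0..})" using assms(2) by (intro bdd_aboveI2[where M = B]) auto
  have "(f \<longlongrightarrow> l) at_top"
  proof (rule order_tendstoI)
    fix y assume "y < l"
    then obtain t where t: "0 \<le> t" "y < f t"
      unfolding l_def using less_cSUP_iff[OF _ bdd, of y] by auto
    have "y < f s" if "t \<le> s" for s
      using t that monotone_onD[OF assms(1), of t s] by simp
    then show "\<forall>\<^sub>F s in at_top. y < f s" by (auto simp: eventually_at_top_linorder)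
  next
    fix y assume "l < y"
    have "f s < y" if "0 \<le> s" for s
      using cSUP_upper[OF _ bdd, of s] that \<open>l < y\<close> by (simp add: l_def)
    then show "\<forall>\<^sub>F s in at_top. f s < y" by (auto simp: eventually_at_top_linorder)
  qed
  then show ?thesis ..
qed

text \<open>A regulator is constant while its reflected process is positive, so it diverges only if the
  process returns to \<open>0\<close> at arbitrarily late times.\<close>
lemma complementary_unbounded_zero:
  assumes l: "regulating l" "filterlim l at_top at_top"
    and w: "complementary w l" "\<And>t. 0 \<le> t \<Longrightarrow> 0 \<le> w t"
  shows "\<exists>s>T. w s = 0"
proof (rule ccontr)
  assume none: "\<not> (\<exists>s>T. w s = 0)"
  define U where "U = max 0 T"
  have "0 \<le> U" by (simp add: U_def)
  have pos: "0 < w s" if "U < s" for s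
  proof -
    have "0 \<le> s" "T < s" using that by (auto simp: U_def)
    then have "w s \<noteq> 0" using none by blast
    with w(2)[OF \<open>0 \<le> s\<close>] show ?thesis by simp
  qed
  have flat: "l t \<le> l U" if "U \<le> t" for t
  proof -
    have "emeasure (stieltjes_measure l) {U<..t} = 0"
      by (rule complementary_null[OF w(1)]) (use \<open>0 \<le> U\<close> pos in auto)
    then show ?thesis
      using that \<open>0 \<le> U\<close> by (simp add: emeasure_stieltjes_Ioc[OF l(1)] ennreal_eq_0_iff)
  qed
  have "\<forall>\<^sub>F t in at_top. l U < l t \<and> U \<le> t"
  proof (rule eventually_conj)
    show "\<forall>\<^sub>F t in at_top. l U < l t" using l(2) unfolding filterlim_at_top_dense by blast
  qed (rule eventually_ge_at_top)
  from eventually_happens'[OF trivial_limit_at_top_linorder this]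
  obtain t where "l U < l t" "U \<le> t" by blast
  with flat[of t] show False by simp
qed

theorem theorem2p1:
  fixes P :: "real^'n^'n" and X :: "real \<Rightarrow> real^'n" and i :: 'n
  assumes "\<And>j k. 0 \<le> P $ j $ k"
    and "matrix_spectral_radius P < 1"
    and "cadlag X"
  defines "W \<equiv> reflected P" and "L \<equiv> regulator P"
  shows "((\<forall>a. (\<forall>j. 0 \<le> a $ j) \<longrightarrow>
             ((\<lambda>t. W (\<lambda>s. a + X s) t $ i - W X t $ i) \<longlongrightarrow> 0) at_top)
          \<longleftrightarrow> (\<exists>a. (\<forall>j. 0 \<le> a $ j) \<and> filterlim (\<lambda>t. L (\<lambda>s. a + X s) t $ i) at_top at_top))
       \<and> ((\<exists>a. (\<forall>j. 0 \<le> a $ j) \<and> filterlim (\<lambda>t. L (\<lambda>s. a + X s) t $ i) at_top at_top)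
          \<longleftrightarrow> (\<forall>a. (\<forall>j. 0 \<le> a $ j) \<longrightarrow> filterlim (\<lambda>t. L (\<lambda>s. a + X s) t $ i) at_top at_top))"
proof -
  define Q where "Q = transpose P"
  obtain v where v: "\<And>j. 0 \<le> v $ j" "\<And>j. v $ j = 1 + (Q *v v) $ j"
    using positive_potential_exists[OF assms(1,2)] unfolding Q_def by blast
  interpret contractive_routing Q v
  proof
    show "0 \<le> Q $ j $ k" for j k using assms(1) by (simp add: Q_def transpose_def)
  qed (rule v)+
  have X: "cadlag (\<lambda>s. a + X s)" for a
    using assms(3) by (rule cadlag_shift)
  have sol': "skorohod_solution (mat 1 - Q) Y (W Y) (L Y)" if Y: "cadlag Y" for Y
  proof -
    obtain W' L' where "skorohod_solution (mat 1 - Q) Y W' L'"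
      using solution_exists[OF Y] by metis
    then have "case (W', L') of (W, L) \<Rightarrow> skorohod_solution (reflection_matrix P) Y W L"
      by (simp add: reflection_matrix_def Q_def)
    then have "case reflection_map P Y of (W, L) \<Rightarrow> skorohod_solution (reflection_matrix P) Y W L"
      unfolding reflection_map_def by (rule someI)
    then show ?thesis
      by (simp add: W_def L_def reflected_def regulator_def reflection_matrix_def Q_def split_beta)
  qed
  have sol: "skorohod_solution (mat 1 - Q) X (W X) (L X)"
    "skorohod_solution (mat 1 - Q) (\<lambda>s. a + X s) (W (\<lambda>s. a + X s)) (L (\<lambda>s. a + X s))" for a
    by (intro sol' X assms(3))+
  let ?Xa = "\<lambda>a s. a + X s"
  have regs: "regulating (\<lambda>t. L (?Xa a) t $ i)" "regulating (\<lambda>t. L X t $ i)" for a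
    using sol(2)[unfolded skorohod_solution_iff[OF X]] sol(1)[unfolded skorohod_solution_iff[OF assms(3)]]
    by auto
  then have mono: "mono_on {0..} (\<lambda>t. L (?Xa a) t $ i)" "mono_on {0..} (\<lambda>t. L X t $ i)" for a
    by (auto simp: regulating_def)
  have D_mono: "mono_on {0..} (\<lambda>t. L X t $ j - L (?Xa a) t $ j)" if "\<forall>j. 0 \<le> a $ j" for a j
    by (rule mono_on_regulator_diff[OF assms(3) X _ sol]) (use that in simp)
  have L_le: "L (?Xa a) t $ j \<le> L X t $ j" if "\<forall>j. 0 \<le> a $ j" "0 \<le> t" for a t j
    by (rule regulator_antimono[OF assms(3) X _ sol]) (use that in simp_all)
  have D_le: "L X t $ j - L (?Xa a) t $ j \<le> (\<Sum>k\<in>UNIV. a $ k) * v $ j"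
    if "\<forall>j. 0 \<le> a $ j" "0 \<le> t" for a t j
    by (rule regulator_diff_bounded[OF assms(3) X _ sol]) (use that in simp_all)
  have W_le: "W X t $ j \<le> W (?Xa a) t $ j" if "\<forall>j. 0 \<le> a $ j" "0 \<le> t" for a t j
    by (rule reflected_shift_mono[OF assms(3) X _ sol]) (use that in simp_all)
  have W_diff: "W (?Xa a) t $ j - W X t $ j
      = a $ j + (Q *v (L X t - L (?Xa a) t)) $ j - (L X t - L (?Xa a) t) $ j"
    if "\<forall>j. 0 \<le> a $ j" "0 \<le> t" for a t j
    by (rule reflected_diff[OF assms(3) X _ sol]) (use that in simp_all)
  have diverges_iff: "filterlim (\<lambda>t. L (?Xa a) t $ i) at_top at_top \<longleftrightarrow>
      filterlim (\<lambda>t. L X t $ i) at_top at_top" if a: "\<forall>j. 0 \<le> a $ j" for a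
    unfolding mono_on_at_top_iff_unbounded[OF mono(1)] mono_on_at_top_iff_unbounded[OF mono(2)]
  proof (intro iffI allI)
    fix B
    assume "\<forall>B. \<exists>t\<ge>0. B \<le> L (?Xa a) t $ i"
    then obtain t where "0 \<le> t" "B \<le> L (?Xa a) t $ i" by blast
    with L_le[OF a, of t i] show "\<exists>t\<ge>0. B \<le> L X t $ i" by (intro exI[of _ t]) simp
  next
    fix B
    assume "\<forall>B. \<exists>t\<ge>0. B \<le> L X t $ i"
    then obtain t where "0 \<le> t" "B + (\<Sum>k\<in>UNIV. a $ k) * v $ i \<le> L X t $ i" by blast
    with D_le[OF a, of t i] show "\<exists>t\<ge>0. B \<le> L (?Xa a) t $ i" by (intro exI[of _ t]) simp
  qed
  have coupling: "((\<lambda>t. W (?Xa a) t $ i - W X t $ i) \<longlongrightarrow> 0) at_top"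
    if lim: "filterlim (\<lambda>t. L X t $ i) at_top at_top" and a: "\<forall>j. 0 \<le> a $ j" for a
  proof -
    let ?D = "\<lambda>t. L X t - L (?Xa a) t"
    have "\<exists>d. ((\<lambda>t. ?D t $ j) \<longlongrightarrow> d) at_top" for j
      using mono_on_bounded_convergent[OF D_mono[OF a] D_le[OF a], of j] by simp
    then obtain d where d: "\<And>j. ((\<lambda>t. ?D t $ j) \<longlongrightarrow> d j) at_top" by metis
    let ?g = "\<lambda>t. a $ i + (Q *v ?D t) $ i - ?D t $ i"
    define g where "g = a $ i + (\<Sum>j\<in>UNIV. Q $ i $ j * d j) - d i"
    have "(?g \<longlongrightarrow> g) at_top"
      unfolding g_def matrix_vector_mult_def vec_lambda_beta
      by (intro tendsto_diff tendsto_add tendsto_sum tendsto_mult tendsto_const d)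
    moreover have "\<forall>\<^sub>F t in at_top. ?g t = W (?Xa a) t $ i - W X t $ i"
      using eventually_ge_at_top[of 0]
      by eventually_elim (simp add: W_diff[OF a])
    ultimately have g: "((\<lambda>t. W (?Xa a) t $ i - W X t $ i) \<longlongrightarrow> g) at_top"
      by (rule Lim_transform_eventually)
    have W: "0 \<le> W Y t $ i" "complementary (\<lambda>t. W Y t $ i) (\<lambda>t. L Y t $ i)"
      if "cadlag Y" "0 \<le> t" for Y t
      using sol'[OF that(1)] that(2) unfolding skorohod_solution_def complementary_def by blast+
    \<comment> \<open>At a late zero of the shifted process the smaller, unshifted one vanishes as well.\<close>
    have "g = 0"
    proof (rule ccontr)
      assume "g \<noteq> 0"
      then have "\<forall>\<^sub>F t in at_top. W (?Xa a) t $ i - W X t $ i \<noteq> 0"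
        using g by (rule tendsto_imp_eventually_ne[rotated])
      then obtain T where T: "\<And>t. T \<le> t \<Longrightarrow> W (?Xa a) t $ i - W X t $ i \<noteq> 0"
        unfolding eventually_at_top_linorder by blast
      have "filterlim (\<lambda>t. L (?Xa a) t $ i) at_top at_top" using lim diverges_iff[OF a] by simp
      from complementary_unbounded_zero[OF regs(1) this W(2)[OF X order_refl] W(1)[OF X], of "max 0 T"]
      obtain t where t: "max 0 T < t" "W (?Xa a) t $ i = 0" by blast
      then have "W X t $ i = 0"
        using W_le[OF a, of t i] W(1)[OF assms(3), of t] by simp
      then show False using T[of t] t by simp
    qed
    with g show ?thesis by simp
  qed
  have diverges: "filterlim (\<lambda>t. L X t $ i) at_top at_top"
    if i: "\<forall>a. (\<forall>j. 0 \<le> a $ j) \<longrightarrow> ((\<lambda>t. W (?Xa a) t $ i - W X t $ i) \<longlongrightarrow> 0) at_top"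
  proof (rule ccontr)
    assume "\<not> ?thesis"
    then obtain B where "\<not> (\<exists>t\<ge>0. B \<le> L X t $ i)"
      unfolding mono_on_at_top_iff_unbounded[OF mono(2)] by blast
    then have B: "L X t $ i < B" if "0 \<le> t" for t
      using that by (metis not_le)
    \<comment> \<open>If the regulator stays below \<open>B\<close>, it cannot absorb a shift by more than \<open>B\<close>.\<close>
    define a :: "real^'n" where "a = axis i (\<bar>B\<bar> + 1)"
    have a: "\<forall>j. 0 \<le> a $ j" by (simp add: a_def axis_def)
    have "1 \<le> W (?Xa a) t $ i - W X t $ i" if t: "0 \<le> t" for t
    proof -
      have "0 \<le> (Q *v (L X t - L (?Xa a) t)) $ i"
        using Q_mono[of 0 "L X t - L (?Xa a) t" i] L_le[OF a t] by simp
      moreover have "0 \<le> L (?Xa a) t $ i" using regs(1)[of a] t by (simp add: regulating_def)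
      ultimately show ?thesis
        using W_diff[OF a t, of i] B[OF t] by (simp add: a_def)
    qed
    then have "\<forall>\<^sub>F t in at_top. 1 \<le> W (?Xa a) t $ i - W X t $ i"
      by (auto simp: eventually_at_top_linorder)
    moreover have "((\<lambda>t. W (?Xa a) t $ i - W X t $ i) \<longlongrightarrow> 0) at_top" using i a by blast
    ultimately have "(1::real) \<le> 0"
      by (intro tendsto_lowerbound) auto
    then show False by simp
  qed
  have zero: "\<forall>j. 0 \<le> (0::real^'n) $ j" by simp
  let ?C = "filterlim (\<lambda>t. L X t $ i) at_top at_top"
  let ?Ca = "\<lambda>a. filterlim (\<lambda>t. L (?Xa a) t $ i) at_top at_top"
  have i: "(\<forall>a. (\<forall>j. 0 \<le> a $ j) \<longrightarrow> ((\<lambda>t. W (?Xa a) t $ i - W X t $ i) \<longlongrightarrow> 0) at_top) \<longleftrightarrow> ?C"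
    (is "?I \<longleftrightarrow> _")
  proof
    assume ?C
    show ?I
    proof (intro allI impI)
      fix a :: "real^'n" assume "\<forall>j. 0 \<le> a $ j"
      then show "((\<lambda>t. W (?Xa a) t $ i - W X t $ i) \<longlongrightarrow> 0) at_top"
        by (rule coupling[OF \<open>?C\<close>])
    qed
  qed (rule diverges)
  have ii: "(\<exists>a. (\<forall>j. 0 \<le> a $ j) \<and> ?Ca a) \<longleftrightarrow> ?C" (is "?II \<longleftrightarrow> _")
  proof
    assume ?C
    then have "?Ca 0" by (rule diverges_iff[OF zero, THEN iffD2])
    from conjI[OF zero this] show ?II by (rule exI)
  next
    assume ?II
    then obtain a where a: "\<forall>j. 0 \<le> a $ j" "?Ca a" by (elim exE conjE)
    from a(2) show ?C by (rule diverges_iff[OF a(1), THEN iffD1])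
  qed
  have iii: "(\<forall>a. (\<forall>j. 0 \<le> a $ j) \<longrightarrow> ?Ca a) \<longleftrightarrow> ?C" (is "?III \<longleftrightarrow> _")
  proof
    assume ?III
    from this[THEN spec, of 0, THEN mp, OF zero] show ?C
      by (rule diverges_iff[OF zero, THEN iffD1])
  next
    assume ?C
    show ?III
    proof (intro allI impI)
      fix a :: "real^'n" assume a: "\<forall>j. 0 \<le> a $ j"
      from \<open>?C\<close> show "?Ca a" by (rule diverges_iff[OF a, THEN iffD2])
    qed
  qed
  show ?thesis
    by (rule conjI[OF trans[OF i ii[symmetric]] trans[OF ii iii[symmetric]]])
qed

end
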